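(* Consider named agents in the asynchronous model with CW whiteboards and half-duplex links. For every $k \ge 1$, the quiescence number of the $k$-gossip problem in this model is $0$; that is, a $0$-quiescent self-stabilizing solution exists and no $l$-quiescent self-stabilizing solution exists for any $l \ge 1$.
   Context: Network: a finite connected graph $G=(V,E)$. Nodes are anonymous (nodes of the same degree are identical). Each node labels its incident links with locally distinct labels; nothing else is assumed about the labels. Each node has a whiteboard (a public memory). Agents: $k$ mobile agents, each a deterministic state machine, are present at all times. In the named agent model each agent has a unique constant identifier from an infinite totally ordered domain (e.g. $\mathbb{N}$). When an agent at a node executes its action, it may change its state, write on the node's whiteboard, and move to a neighboring node (or stay), based only on: its own state (and identifier), the states of the agents currently at the same node, the local link labels of the node (and possibly the label of the incoming link), and the contents of the node's whiteboard. The algorithm is the same for all agents; it is given neither $k$ nor the network. Asynchronous model: there is no bound on the number of moves an agent can make between two moves of another agent, but each agent is always eventually allowed to execute its action; agents at the same node act sequentially, agents at different nodes may act concurrently. Half-duplex links: only one direction of a link can be used at a given time; if two agents at opposite ends try to cross simultaneously, only one succeeds (so agents cannot swap positions over a link without meeting). CW whiteboards: only control information can be stored on whiteboards, not gossip information. $k$-gossip problem: each of the $k$ agents is given an initial piece of information (gossip information), treated as opaque. With CW whiteboards, gossip information is transferred from agent to agent only by meeting at a node; agents may relay all gossip information collected. The goal is that every agent obtains the gossip information of all agents. Self-stabilizing solution: one algorithm, not depending on $k$ or on the network, such that for every network, every number of agents, and every initial configuration (arbitrary agent locations and states, arbitrary whiteboard contents), in every execution every agent eventually knows the gossip information of all agents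 in the system. $l$-quiescent (for an integer $l$, when $k$ agents are present): every execution with $k$ agents reaches a configuration after which $l$ or more agents remain still (never move) forever. The quiescence number of the $k$-gossip problem in a model is the maximum integer $l$ such that an $l$-quiescent self-stabilizing solution exists, and it is $-1$ if no $0$-quiescent self-stabilizing solution exists. *)

theory Defs
  imports Main
begin

text \<open>
  A network is a finite connected simple graph.  A link between \<open>u\<close> and \<open>v\<close> is represented by both
  ordered pairs, and \<open>label N u v\<close> is the label that \<open>u\<close> assigns to it.  Only local distinctness of
  labels is required; the two ends of a link may use different labels.
\<close>

record network =
  nodes :: "nat set"
  links :: "(nat \<times> nat) set"
  label :: "nat \<Rightarrow> nat \<Rightarrow> nat"

definition valid_network :: "network \<Rightarrow> bool" where
  "valid_network N \<longleftrightarrow>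
     finite (nodes N) \<and> nodes N \<noteq> {} \<and>
     links N \<subseteq> nodes N \<times> nodes N \<and> sym (links N) \<and> irrefl (links N) \<and>
     (\<forall>u\<in>nodes N. \<forall>v\<in>nodes N. (u, v) \<in> (links N)\<^sup>*) \<and>
     (\<forall>u\<in>nodes N. inj_on (label N u) {v. (u, v) \<in> links N})"

definition ports :: "network \<Rightarrow> nat \<Rightarrow> nat set" where
  "ports N u = label N u ` {v. (u, v) \<in> links N}"

definition neighbour :: "network \<Rightarrow> nat \<Rightarrow> nat \<Rightarrow> nat" where
  "neighbour N u p = (THE v. (u, v) \<in> links N \<and> label N u v = p)"

text \<open>
  Agents are named by natural numbers.  The components of a configuration are only meaningful for the
  agents present and the nodes of the network.  \<open>arrival c a\<close> is the label, at the current node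
  of \<open>a\<close>, of the link through which \<open>a\<close> entered that node, if \<open>a\<close> has moved.
\<close>

record ('s, 'w) config =
  location :: "nat \<Rightarrow> nat"
  state :: "nat \<Rightarrow> 's"
  arrival :: "nat \<Rightarrow> nat option"
  whiteboard :: "nat \<Rightarrow> 'w"

text \<open>
  A view is everything an action may depend on.  It contains neither the name of the node nor any
  gossip information.
\<close>

record ('s, 'w) view =
  own_id :: nat
  own_state :: 's
  others :: "(nat \<times> 's) set"
  port_labels :: "nat set"
  in_port :: "nat option"
  board :: 'w

text \<open>
  An algorithm maps a view to the new state, the new whiteboard content and the label of the link
  to be taken, \<open>None\<close> meaning to stay.
\<close>

type_synonym ('s, 'w) algorithm = "('s, 'w) view \<Rightarrow> 's \<times> 'w \<times> nat option"

definition view_of ::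
  "network \<Rightarrow> nat set \<Rightarrow> ('s, 'w) config \<Rightarrow> nat \<Rightarrow> ('s, 'w) view" where
  "view_of N I c a =
     \<lparr> own_id = a,
       own_state = state c a,
       others = {(b, state c b) | b. b \<in> I \<and> b \<noteq> a \<and> location c b = location c a},
       port_labels = ports N (location c a),
       in_port = arrival c a,
       board = whiteboard c (location c a) \<rparr>"

definition new_state ::
  "('s, 'w) algorithm \<Rightarrow> network \<Rightarrow> nat set \<Rightarrow> ('s, 'w) config \<Rightarrow> nat \<Rightarrow> 's" where
  "new_state A N I c a = fst (A (view_of N I c a))"

definition new_board ::
  "('s, 'w) algorithm \<Rightarrow> network \<Rightarrow> nat set \<Rightarrow> ('s, 'w) config \<Rightarrow> nat \<Rightarrow> 'w" where
  "new_board A N I c a = fst (snd (A (view_of N I c a)))"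

text \<open>A label that does not occur at the current node is read as staying.\<close>

definition destination ::
  "('s, 'w) algorithm \<Rightarrow> network \<Rightarrow> nat set \<Rightarrow> ('s, 'w) config \<Rightarrow> nat \<Rightarrow> nat" where
  "destination A N I c a =
     (case snd (snd (A (view_of N I c a))) of
        None \<Rightarrow> location c a
      | Some p \<Rightarrow>
          if p \<in> ports N (location c a) then neighbour N (location c a) p else location c a)"

definition new_arrival ::
  "('s, 'w) algorithm \<Rightarrow> network \<Rightarrow> nat set \<Rightarrow> ('s, 'w) config \<Rightarrow> nat \<Rightarrow> nat option" where
  "new_arrival A N I c a =
     (if destination A N I c a = location c a then arrival c a
      else Some (label N (destination A N I c a) (location c a)))"

text \<open>
  In one step a set \<open>S\<close> of agents at pairwise different nodes act concurrently; agents at the same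
  node act in different steps.  Half-duplex links: two agents never cross the same link in opposite
  directions in one step.  An agent that loses such a conflict does not act in the step.
\<close>

definition half_duplex ::
  "('s, 'w) algorithm \<Rightarrow> network \<Rightarrow> nat set \<Rightarrow> ('s, 'w) config \<Rightarrow> nat set \<Rightarrow> bool" where
  "half_duplex A N I c S \<longleftrightarrow>
     (\<forall>a\<in>S. \<forall>b\<in>S. a \<noteq> b \<longrightarrow>
        \<not> (destination A N I c a = location c b \<and> destination A N I c b = location c a))"

definition step ::
  "('s, 'w) algorithm \<Rightarrow> network \<Rightarrow> nat set \<Rightarrow> nat set \<Rightarrow>
     ('s, 'w) config \<Rightarrow> ('s, 'w) config \<Rightarrow> bool" where
  "step A N I S c c' \<longleftrightarrow>
     S \<subseteq> I \<and> inj_on (location c) S \<and> half_duplex A N I c S \<and>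
     (\<forall>a. location c' a = (if a \<in> S then destination A N I c a else location c a)) \<and>
     (\<forall>a. state c' a = (if a \<in> S then new_state A N I c a else state c a)) \<and>
     (\<forall>a. arrival c' a = (if a \<in> S then new_arrival A N I c a else arrival c a)) \<and>
     (\<forall>a\<in>S. whiteboard c' (location c a) = new_board A N I c a) \<and>
     (\<forall>v. v \<notin> location c ` S \<longrightarrow> whiteboard c' v = whiteboard c v)"

text \<open>States and whiteboards of an initial configuration are arbitrary, hence unconstrained.\<close>

definition initial :: "network \<Rightarrow> nat set \<Rightarrow> ('s, 'w) config \<Rightarrow> bool" where
  "initial N I c \<longleftrightarrow>
     (\<forall>a\<in>I. location c a \<in> nodes N \<and>
        (arrival c a = None \<or> (\<exists>p\<in>ports N (location c a). arrival c a = Some p)))"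

text \<open>The last conjunct is fairness: each agent acts infinitely often.\<close>

definition execution ::
  "('s, 'w) algorithm \<Rightarrow> network \<Rightarrow> nat set \<Rightarrow> (nat \<Rightarrow> ('s, 'w) config) \<Rightarrow> bool" where
  "execution A N I c \<longleftrightarrow>
     initial N I (c 0) \<and>
     (\<exists>S. (\<forall>t. step A N I (S t) (c t) (c (Suc t))) \<and>
          (\<forall>a\<in>I. \<forall>t. \<exists>t'\<ge>t. a \<in> S t'))"

text \<open>
  \<open>knows I c t a b\<close>: at time \<open>t\<close> agent \<open>a\<close> has the gossip information of agent \<open>b\<close>.  Whiteboards
  carry control information only, so gossip spreads only among agents located at the same node, which
  then share all they have.
\<close>

inductive knows ::
  "nat set \<Rightarrow> (nat \<Rightarrow> ('s, 'w) config) \<Rightarrow> nat \<Rightarrow> nat \<Rightarrow> nat \<Rightarrow> bool"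
  for I :: "nat set" and c :: "nat \<Rightarrow> ('s, 'w) config" where
  own: "a \<in> I \<Longrightarrow> knows I c 0 a a"
| keep: "knows I c t a b \<Longrightarrow> knows I c (Suc t) a b"
| meet: "knows I c t a b \<Longrightarrow> a' \<in> I \<Longrightarrow> location (c t) a' = location (c t) a \<Longrightarrow> knows I c t a' b"

definition self_stabilizing_gossip :: "('s, 'w) algorithm \<Rightarrow> bool" where
  "self_stabilizing_gossip A \<longleftrightarrow>
     (\<forall>N I c. valid_network N \<longrightarrow> finite I \<longrightarrow> I \<noteq> {} \<longrightarrow> execution A N I c \<longrightarrow>
        (\<forall>a\<in>I. \<exists>t. \<forall>b\<in>I. knows I c t a b))"

text \<open>
  Moving always changes the location because links join different nodes, so an agent is still
  from time \<open>t\<close> on if and only if its location is constant from then on.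
\<close>

definition quiescent :: "('s, 'w) algorithm \<Rightarrow> nat \<Rightarrow> int \<Rightarrow> bool" where
  "quiescent A k l \<longleftrightarrow>
     (\<forall>N I c. valid_network N \<longrightarrow> finite I \<longrightarrow> card I = k \<longrightarrow> execution A N I c \<longrightarrow>
        (\<exists>t. \<exists>Q\<subseteq>I. l \<le> int (card Q) \<and>
           (\<forall>a\<in>Q. \<forall>t'\<ge>t. location (c t') a = location (c t) a)))"

definition quiescence_number :: "'s itself \<Rightarrow> 'w itself \<Rightarrow> nat \<Rightarrow> int" where
  "quiescence_number T W k =
     (if \<exists>A :: ('s, 'w) algorithm. self_stabilizing_gossip A \<and> quiescent A k 0
      then GREATEST l. \<exists>A :: ('s, 'w) algorithm. self_stabilizing_gossip A \<and> quiescent A k l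
      else - 1)"

end

theory Submission
  imports Defs "HOL-Library.Countable"
begin

text \<open>
  No agent can be made to rest.  Call a group of agents stuck if, alone at a node of degree one, it
  can act fairly forever without any of its members leaving.  Two disjoint stuck groups at the two
  ends of a single link never exchange gossip, so all stuck groups intersect a fixed finite set of
  names.  Among agents with other names, the adversary runs the group around a chosen agent until
  that agent leaves its node, and does so for each agent again and again.

  Gossip without rest.  At every node, each agent owns a slot of the whiteboard with a rotor and a
  trail, that is, the list of the ports through which it has entered nodes so far.  An agent
  advances by its private rotor-router, except that it first retraces the trail of a smaller name
  whenever that trail is longer than the number of times it has already retraced this name.  Slots
  of smaller names that are not present never change, so the least agent eventually follows its
  rotors only; its walk is then periodic and visits all nodes.  Every other agent retraces ever
  longer parts of that walk backwards.  While the least agent is at index \<open>x\<close> of its walk and the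
  other one at index \<open>y\<close>, the difference \<open>x - y\<close> grows in steps of one or two, and they meet when it
  is a multiple of the period; jumping over a multiple would be a swap over a link, which half-duplex
  links exclude.
\<close>

subsection \<open>Restless executions on a single link\<close>

text \<open>Both ends use label 0, so a view does not reveal at which end an agent stands. A
  behaviour observed at one end can therefore be replayed at the other.\<close>

definition edge_network :: network where
  "edge_network = \<lparr>nodes = {0, 1}, links = {(0, 1), (1, 0)}, label = (\<lambda>_ _. 0)\<rparr>"

lemma valid_edge_network: "valid_network edge_network"
proof -
  have "(u, v) \<in> {(0, 1), (1, 0)}\<^sup>*" if "u \<in> {0, 1}" "v \<in> {0, 1}" for u v :: nat
    using that by auto
  then show ?thesis
    by (auto simp: valid_network_def edge_network_def sym_def irrefl_def inj_on_def)
qed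

lemma ports_edge_network: "u \<in> {0, 1} \<Longrightarrow> ports edge_network u = {0}"
  by (auto simp: ports_def edge_network_def)

lemma neighbour_edge_network: "u \<in> {0, 1} \<Longrightarrow> neighbour edge_network u 0 = 1 - u"
  by (auto simp: neighbour_def edge_network_def)

section \<open>Stuck groups\<close>

definition local_view ::
  "nat set \<Rightarrow> (nat \<Rightarrow> 's) \<Rightarrow> (nat \<Rightarrow> nat option) \<Rightarrow> 'w \<Rightarrow> nat \<Rightarrow> ('s, 'w) view" where
  "local_view G st ar w a =
     \<lparr> own_id = a, own_state = st a, others = {(b, st b) | b. b \<in> G \<and> b \<noteq> a},
       port_labels = {0}, in_port = ar a, board = w \<rparr>"

text \<open>A stuck run is described by the data of one node alone, so it can be placed at either
  end of the link. The arrival labels \<open>ar\<close> do not depend on time because nobody moves.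
  Port 0 is the only one, and every other answer is read as staying.\<close>

definition stuck :: "('s, 'w) algorithm \<Rightarrow> nat set \<Rightarrow> bool" where
  "stuck A G \<longleftrightarrow> finite G \<and> G \<noteq> {} \<and>
     (\<exists>st w ar g. (\<forall>a\<in>G. ar a \<in> {None, Some 0}) \<and> (\<forall>t. g t \<in> G) \<and>
        (\<forall>a\<in>G. \<forall>t. \<exists>t'\<ge>t. g t' = a) \<and>
        (\<forall>t. st (Suc t) = (st t)(g t := fst (A (local_view G (st t) ar (w t) (g t)))) \<and>
             w (Suc t) = fst (snd (A (local_view G (st t) ar (w t) (g t)))) \<and>
             snd (snd (A (local_view G (st t) ar (w t) (g t)))) \<noteq> Some 0))"

lemma knows_location_invariant:
  assumes "knows I c t a b" and "\<And>t a. location (c t) a = L a"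
  shows "L a = L b"
  using assms(1) by induction (simp_all add: assms(2))

text \<open>Put the two groups at opposite ends and run both schedules in lockstep. Each group sees
  only its own node, hence behaves as if alone; nobody ever leaves, so no gossip crosses the link.
  Disjointness makes the union a legal set of distinct names.\<close>

lemma disjoint_stuck_contradiction:
  assumes A: "self_stabilizing_gossip A"
    and G: "stuck A G" and G': "stuck A G'" and disj: "G \<inter> G' = {}"
  shows False
proof -
  obtain st w ar g where fin: "finite G" "G \<noteq> {}" and ar: "\<And>a. a \<in> G \<Longrightarrow> ar a \<in> {None, Some 0}"
    and g: "\<And>t. g t \<in> G" and fair: "\<And>a t. a \<in> G \<Longrightarrow> \<exists>t'\<ge>t. g t' = a"
    and st: "\<And>t. st (Suc t) = (st t)(g t := fst (A (local_view G (st t) ar (w t) (g t))))"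
    and w: "\<And>t. w (Suc t) = fst (snd (A (local_view G (st t) ar (w t) (g t))))"
    and d: "\<And>t. snd (snd (A (local_view G (st t) ar (w t) (g t)))) \<noteq> Some 0"
    using G unfolding stuck_def by metis
  obtain st' w' ar' g' where fin': "finite G'" "G' \<noteq> {}"
    and ar': "\<And>a. a \<in> G' \<Longrightarrow> ar' a \<in> {None, Some 0}"
    and g': "\<And>t. g' t \<in> G'" and fair': "\<And>a t. a \<in> G' \<Longrightarrow> \<exists>t'\<ge>t. g' t' = a"
    and st': "\<And>t. st' (Suc t) = (st' t)(g' t := fst (A (local_view G' (st' t) ar' (w' t) (g' t))))"
    and w': "\<And>t. w' (Suc t) = fst (snd (A (local_view G' (st' t) ar' (w' t) (g' t))))"
    and d': "\<And>t. snd (snd (A (local_view G' (st' t) ar' (w' t) (g' t)))) \<noteq> Some 0"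
    using G' unfolding stuck_def by metis
  \<comment> \<open>The two given runs are glued: \<open>G\<close> lives at node 0 with board
    \<open>w\<close>, \<open>G'\<close> at node 1 with board \<open>w'\<close>.\<close>
  define c where "c t = \<lparr>location = (\<lambda>a. if a \<in> G then 0 else 1),
      state = (\<lambda>a. if a \<in> G then st t a else st' t a),
      arrival = (\<lambda>a. if a \<in> G then ar a else ar' a),
      whiteboard = (\<lambda>v. if v = 0 then w t else if v = 1 then w' t else undefined)\<rparr>" for t
  let ?I = "G \<union> G'"
  have notin: "a \<notin> G" if "a \<in> G'" for a using that disj by blast
  have g'n: "g' t \<notin> G" for t using g' notin by blast
  have view: "view_of edge_network ?I (c t) (g t) = local_view G (st t) ar (w t) (g t)" for t
    using g[of t] by (auto simp: view_of_def local_view_def c_def ports_edge_network)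
  have view': "view_of edge_network ?I (c t) (g' t) = local_view G' (st' t) ar' (w' t) (g' t)" for t
    using g'[of t] g'n[of t] notin
    by (auto simp: view_of_def local_view_def c_def ports_edge_network)
  have loc: "location (c t) (g t) = 0" "location (c t) (g' t) = 1" for t
    using g g'n by (simp_all add: c_def)
  have dest: "destination A edge_network ?I (c t) (g t) = 0" for t
    using d[of t] by (auto simp: destination_def view loc ports_edge_network split: option.split)
  have dest': "destination A edge_network ?I (c t) (g' t) = 1" for t
    using d'[of t] by (auto simp: destination_def view' loc ports_edge_network split: option.split)
  have step: "step A edge_network ?I {g t, g' t} (c t) (c (Suc t))" for t
    unfolding step_def
  proof (intro conjI)
    show "{g t, g' t} \<subseteq> ?I" using g g' by blast
    show "inj_on (location (c t)) {g t, g' t}" by (auto simp: inj_on_def loc)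
    show "half_duplex A edge_network ?I (c t) {g t, g' t}"
      using g g'n by (auto simp: half_duplex_def dest dest') (auto simp: c_def)
    show "\<forall>a. location (c (Suc t)) a =
        (if a \<in> {g t, g' t} then destination A edge_network ?I (c t) a else location (c t) a)"
      using g[of t] g'n[of t] by (auto simp: dest dest') (auto simp: c_def)
    show "\<forall>a. state (c (Suc t)) a =
        (if a \<in> {g t, g' t} then new_state A edge_network ?I (c t) a else state (c t) a)"
      using g[of t] g'n[of t] by (auto simp: new_state_def view view') (auto simp: c_def st st')
    show "\<forall>a. arrival (c (Suc t)) a =
        (if a \<in> {g t, g' t} then new_arrival A edge_network ?I (c t) a else arrival (c t) a)"
      using g[of t] g'n[of t] by (auto simp: new_arrival_def dest dest') (auto simp: c_def)
    show "\<forall>a\<in>{g t, g' t}. whiteboard (c (Suc t)) (location (c t) a) =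
        new_board A edge_network ?I (c t) a"
      using g[of t] g'n[of t] by (auto simp: new_board_def view view') (auto simp: c_def w w')
    show "\<forall>v. v \<notin> location (c t) ` {g t, g' t} \<longrightarrow> whiteboard (c (Suc t)) v = whiteboard (c t) v"
      using g[of t] g'n[of t] by (auto simp: c_def)
  qed
  have "initial edge_network ?I (c 0)"
    using ar ar' notin
    by (auto simp: initial_def c_def ports_edge_network) (auto simp: edge_network_def)
  moreover have "\<exists>t'\<ge>t. a \<in> {g t', g' t'}" if "a \<in> ?I" for a t
    using that fair[of a t] fair'[of a t] by auto
  ultimately have "execution A edge_network ?I c"
    unfolding execution_def using step by (auto intro!: exI[of _ "\<lambda>t. {g t, g' t}"])
  moreover obtain a b where a: "a \<in> G" and b: "b \<in> G'" using fin fin' by blast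
  ultimately obtain t where t: "\<And>b. b \<in> ?I \<Longrightarrow> knows ?I c t a b"
    using A valid_edge_network fin fin' a unfolding self_stabilizing_gossip_def
    by (metis UnCI finite_UnI Un_empty)
  have "knows ?I c t a b" using t b by blast
  from knows_location_invariant[OF this, of "\<lambda>a. if a \<in> G then 0 else 1"]
  show False using a b notin by (simp add: c_def)
qed

section \<open>Sequential runs on the single link\<close>

definition act ::
  "('s, 'w) algorithm \<Rightarrow> network \<Rightarrow> nat set \<Rightarrow> nat \<Rightarrow> ('s, 'w) config \<Rightarrow> ('s, 'w) config" where
  "act A N I a c =
     \<lparr> location = (location c)(a := destination A N I c a),
       state = (state c)(a := new_state A N I c a),
       arrival = (arrival c)(a := new_arrival A N I c a),
       whiteboard = (whiteboard c)(location c a := new_board A N I c a) \<rparr>"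

lemma step_act: "a \<in> I \<Longrightarrow> step A N I {a} c (act A N I a c)"
  by (auto simp: step_def act_def half_duplex_def)

lemma location_fold_act: "a \<notin> set as \<Longrightarrow> location (fold (act A N I) as c) a = location c a"
  by (induction as arbitrary: c) (auto simp: act_def)

lemma destination_edge_network:
  assumes "location c a \<in> {0, 1}"
  shows "destination A edge_network I c a =
    (if snd (snd (A (view_of edge_network I c a))) = Some 0 then 1 - location c a else location c a)"
  using assms ports_edge_network[OF assms] neighbour_edge_network[OF assms]
  by (auto simp: destination_def split: option.split)

lemma initial_edge_network_iff:
  "initial edge_network I c \<longleftrightarrow> (\<forall>a\<in>I. location c a \<in> {0, 1} \<and> arrival c a \<in> {None, Some 0})"
proof -
  have nodes: "nodes edge_network = {0, 1}" by (simp add: edge_network_def)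
  show ?thesis unfolding initial_def nodes
    by (intro ball_cong conj_cong refl) (auto simp only: ports_edge_network bex_simps insert_iff empty_iff)
qed

text \<open>Arbitrary states and whiteboards are allowed initially, so \<open>initial\<close>
  doubles as an invariant: what holds for initial configurations can be applied again in the middle
  of a run.\<close>

lemma initial_act:
  assumes "initial edge_network I c" "a \<in> I"
  shows "initial edge_network I (act A edge_network I a c)"
proof -
  have "destination A edge_network I c a \<in> {0, 1}"
    using assms by (auto simp: initial_edge_network_iff destination_edge_network)
  moreover have "new_arrival A edge_network I c a \<in> {None, Some 0}"
    using assms by (auto simp: initial_edge_network_iff new_arrival_def) (simp_all add: edge_network_def)
  ultimately show ?thesis
    using assms unfolding initial_edge_network_iff by (simp add: act_def)
qed

lemma initial_fold_act:
  assumes "initial edge_network I c" "set as \<subseteq> I"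
  shows "initial edge_network I (fold (act A edge_network I) as c)"
  using assms by (induction as arbitrary: c) (auto simp: initial_act)

lemma finite_fair_schedule:
  fixes G :: "'a set"
  assumes "finite G" "G \<noteq> {}"
  shows "\<exists>g :: nat \<Rightarrow> 'a. (\<forall>t. g t \<in> G) \<and> (\<forall>a\<in>G. \<forall>t. \<exists>t'\<ge>t. g t' = a)"
proof -
  obtain xs where xs: "set xs = G" using assms(1) finite_list by blast
  then have ne: "xs \<noteq> []" using assms(2) by auto
  define g where "g t = xs ! (t mod length xs)" for t
  have "g t \<in> G" for t
    using ne nth_mem[of "t mod length xs" xs] by (simp add: g_def xs)
  moreover have "\<exists>t'\<ge>t. g t' = a" if a: "a \<in> G" for a t
  proof -
    obtain i where i: "i < length xs" "xs ! i = a" using a unfolding xs[symmetric] in_set_conv_nth by blast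
    have "t * length xs + i \<ge> t" using ne by (cases xs) auto
    moreover have "g (t * length xs + i) = a" using i by (simp add: g_def)
    ultimately show ?thesis by blast
  qed
  ultimately show ?thesis by blast
qed

text \<open>Let the agents at the node of \<open>a\<close> act round robin. If none of them ever
  left, this very run would show that the group is stuck. At the first change of location only the
  acting agent has moved.\<close>

lemma some_agent_leaves:
  assumes ini: "initial edge_network I c" and fin: "finite I" and a: "a \<in> I"
    and G: "G = {b \<in> I. location c b = location c a}" and not_stuck: "\<not> stuck A G"
  shows "\<exists>as b. set as \<subseteq> I \<and> b \<in> G \<and>
    (\<forall>b'. b' \<noteq> b \<longrightarrow> location (fold (act A edge_network I) as c) b' = location c b') \<and>
    location (fold (act A edge_network I) as c) b \<noteq> location c b"
proof -
  have finG: "finite G" "G \<noteq> {}" and GI: "G \<subseteq> I" using fin a G by auto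
  obtain g :: "nat \<Rightarrow> nat" where g: "\<And>t. g t \<in> G" and fair: "\<And>b t. b \<in> G \<Longrightarrow> \<exists>t'\<ge>t. g t' = b"
    using finite_fair_schedule[OF finG] by blast
  define C where "C t = fold (act A edge_network I) (map g [0..<t]) c" for t
  have C0: "C 0 = c" and CS: "C (Suc t) = act A edge_network I (g t) (C t)" for t
    by (simp_all add: C_def)
  have loc01: "location c a \<in> {0, 1}" using ini a unfolding initial_edge_network_iff by blast
  have "\<exists>t. location (C t) \<noteq> location c"
  proof (rule ccontr)
    assume "\<not> ?thesis"
    then have loc: "location (C t) = location c" for t by blast
    have view: "view_of edge_network I (C t) (g t) =
        local_view G (state (C t)) (arrival c) (whiteboard (C t) (location c a)) (g t)"
      if "\<And>b. b \<in> I \<Longrightarrow> arrival (C t) b = arrival c b" for t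
      using g[of t] that[of "g t"] loc01 G
      by (auto simp: view_of_def local_view_def loc ports_edge_network)
    have dst: "destination A edge_network I (C t) (g t) = location c (g t)" for t
      using loc[of "Suc t"] unfolding CS by (simp add: act_def loc) (metis fun_upd_same)
    have arr: "arrival (C t) = arrival c" for t
      by (induction t) (auto simp: C0 CS act_def new_arrival_def dst loc)
    note view = view[unfolded arr, OF refl]
    have "stuck A G" unfolding stuck_def
    proof (intro conjI exI[of _ "\<lambda>t. state (C t)"] exI[of _ "arrival c"]
        exI[of _ "\<lambda>t. whiteboard (C t) (location c a)"] exI[of _ g] allI ballI)
      show "finite G" "G \<noteq> {}" by (fact finG)+
      show "arrival c b \<in> {None, Some 0}" if "b \<in> G" for b
        using ini that GI unfolding initial_edge_network_iff by blast
      show "g t \<in> G" for t by (rule g)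
      show "\<exists>t'\<ge>t. g t' = b" if "b \<in> G" for b t by (rule fair[OF that])
      fix t
      have gl: "location c (g t) = location c a" using g[of t] G by simp
      show "state (C (Suc t)) = (state (C t))(g t := fst (A (local_view G (state (C t)) (arrival c)
          (whiteboard (C t) (location c a)) (g t))))"
        by (simp add: CS act_def new_state_def view)
      show "whiteboard (C (Suc t)) (location c a) = fst (snd (A (local_view G (state (C t)) (arrival c)
          (whiteboard (C t) (location c a)) (g t))))"
        by (simp add: CS act_def new_board_def view loc gl)
      show "snd (snd (A (local_view G (state (C t)) (arrival c)
          (whiteboard (C t) (location c a)) (g t)))) \<noteq> Some 0"
      proof
        assume "snd (snd (A (local_view G (state (C t)) (arrival c)
            (whiteboard (C t) (location c a)) (g t)))) = Some 0"
        then have "destination A edge_network I (C t) (g t) = 1 - location c a"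
          using loc01 by (subst destination_edge_network) (simp_all only: loc gl view simp_thms if_True)
        then show False using loc01 unfolding dst gl by auto
      qed
    qed
    then show False using not_stuck by blast
  qed
  \<comment> \<open>The first time at which the locations differ from those of \<open>c\<close>; the
    action just before it is the departure.\<close>
  then obtain t where t: "location (C t) \<noteq> location c"
    and before: "\<And>s. s < t \<Longrightarrow> location (C s) = location c"
    unfolding exists_least_iff[of "\<lambda>t. location (C t) \<noteq> location c"] by blast
  then obtain s where s: "t = Suc s" using C0 by (cases t) auto
  have upd: "location (C t) = (location c)(g s := destination A edge_network I (C s) (g s))"
    using before[of s] by (simp add: s CS act_def)
  show ?thesis
  proof (intro exI conjI)
    show "set (map g [0..<t]) \<subseteq> I" using g GI by auto
    show "g s \<in> G" by (rule g)
    show "\<forall>b'. b' \<noteq> g s \<longrightarrow> location (fold (act A edge_network I) (map g [0..<t]) c) b' = location c b'"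
      using upd unfolding C_def by simp
    show "location (fold (act A edge_network I) (map g [0..<t]) c) (g s) \<noteq> location c (g s)"
      using upd t unfolding C_def by auto
  qed
qed

text \<open>Whenever some agent leaves the node of \<open>a\<close>, it is either \<open>a\<close>
  itself, or the company of \<open>a\<close> shrinks because all others stay put. Induction on the
  size of that company ends with \<open>a\<close> leaving.\<close>

lemma agent_can_be_moved:
  assumes "initial edge_network I c" "finite I" "a \<in> I" and "\<And>G. G \<subseteq> I \<Longrightarrow> \<not> stuck A G"
  shows "\<exists>as. set as \<subseteq> I \<and> location (fold (act A edge_network I) as c) a \<noteq> location c a"
  using assms(1)
proof (induction "card {b \<in> I. location c b = location c a}" arbitrary: c rule: less_induct)
  case less
  let ?G = "{b \<in> I. location c b = location c a}"
  have "\<not> stuck A ?G" using assms(4)[of ?G] by auto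
  then obtain as b where as: "set as \<subseteq> I" and b: "b \<in> ?G"
    and rest: "\<And>b'. b' \<noteq> b \<Longrightarrow>
      location (fold (act A edge_network I) as c) b' = location c b'"
    and moved: "location (fold (act A edge_network I) as c) b \<noteq> location c b"
    using some_agent_leaves[OF less.prems assms(2,3) refl] by blast
  let ?c = "fold (act A edge_network I) as c"
  show ?case
  proof (cases "a = b")
    case True
    then show ?thesis using as moved by blast
  next
    case False
    have "{b' \<in> I. location ?c b' = location ?c a} \<subseteq> ?G - {b}"
      using rest moved False assms(3) b by fastforce
    then have "card {b' \<in> I. location ?c b' = location ?c a} < card ?G"
      using b assms(2) by (intro psubset_card_mono) auto
    from less.hyps[OF this initial_fold_act[OF less.prems as]]
    obtain as' where as': "set as' \<subseteq> I" "location (fold (act A edge_network I) as' ?c) a \<noteq> location ?c a"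
      by blast
    moreover have "location ?c a = location c a" using rest False assms(3) by blast
    ultimately show ?thesis using as by (intro exI[of _ "as @ as'"]) simp
  qed
qed

text \<open>Concatenate finite schedules, the one of round \<open>n\<close> changing the location of
  agent \<open>g n\<close>, where \<open>g\<close> names every agent infinitely often.\<close>

lemma restless_execution:
  fixes A :: "('s, 'w) algorithm" and c0 :: "('s, 'w) config"
  assumes ini: "initial edge_network I c0" and fin: "finite I" "I \<noteq> {}"
    and not_stuck: "\<And>G. G \<subseteq> I \<Longrightarrow> \<not> stuck A G"
  obtains c where "execution A edge_network I c"
    "\<And>a t. a \<in> I \<Longrightarrow> \<exists>t'\<ge>t. location (c t') a \<noteq> location (c t) a"
proof -
  obtain g :: "nat \<Rightarrow> nat" where g: "\<And>n. g n \<in> I" and fair: "\<And>a n. a \<in> I \<Longrightarrow> \<exists>n'\<ge>n. g n' = a"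
    using finite_fair_schedule[OF fin] by blast
  have "\<exists>P. \<forall>c a. initial edge_network I c \<longrightarrow> a \<in> I \<longrightarrow>
      set (P c a) \<subseteq> I \<and> location (fold (act A edge_network I) (P c a) c) a \<noteq> location c a"
    using agent_can_be_moved[OF _ fin(1) _ not_stuck] by metis
  then obtain P where P: "\<And>c a. initial edge_network I c \<Longrightarrow> a \<in> I \<Longrightarrow> set (P c a) \<subseteq> I"
    "\<And>c a. initial edge_network I c \<Longrightarrow> a \<in> I \<Longrightarrow>
       location (fold (act A edge_network I) (P c a) c) a \<noteq> location c a" by blast
  \<comment> \<open>\<open>d n\<close> is the configuration at the beginning of round
    \<open>n\<close>.\<close>
  define d where "d = rec_nat c0 (\<lambda>n c. fold (act A edge_network I) (P c (g n)) c)"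
  have d0: "d 0 = c0" and dS: "d (Suc n) = fold (act A edge_network I) (P (d n) (g n)) (d n)" for n
    by (simp_all add: d_def)
  have inid: "initial edge_network I (d n)" for n
  proof (induction n)
    case (Suc n)
    then show ?case unfolding dS by (intro initial_fold_act P(1) g)
  qed (simp add: d0 ini)
  define as where "as n = P (d n) (g n)" for n
  have as: "set (as n) \<subseteq> I" for n unfolding as_def by (rule P(1)[OF inid g])
  have "as n \<noteq> []" for n
    using P(2)[OF inid[of n] g[of n]] by (auto simp: as_def)
  then have ne: "length (as n) > 0" for n by simp
  \<comment> \<open>\<open>L n\<close> is the time at which round \<open>n\<close> begins.\<close>
  define L where "L n = (\<Sum>i<n. length (as i))" for n
  have LS: "L (Suc n) = L n + length (as n)" for n by (simp add: L_def)
  have L0: "L 0 = 0" by (simp add: L_def)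
  have Lmono: "strict_mono L" using ne by (simp add: strict_mono_Suc_iff LS)
  have Lge: "n \<le> L n" for n using Lmono by (rule strict_mono_imp_increasing)
  \<comment> \<open>\<open>ph t\<close> is the round that contains time \<open>t\<close>.\<close>
  define ph where "ph t = (LEAST n. t < L (Suc n))" for t
  have ph: "t < L (Suc (ph t))" "L (ph t) \<le> t" for t
  proof -
    have "t < L (Suc t)" using Lge[of "Suc t"] by simp
    then show "t < L (Suc (ph t))" unfolding ph_def by (rule LeastI)
    show "L (ph t) \<le> t"
    proof (cases "ph t")
      case (Suc n)
      then have "n < ph t" by simp
      then have "\<not> t < L (Suc n)" unfolding ph_def by (rule not_less_Least)
      then show ?thesis using Suc by simp
    qed (simp add: L0)
  qed
  have phI: "ph t = n" if "L n \<le> t" "t < L (Suc n)" for t n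
  proof (rule antisym)
    show "ph t \<le> n" unfolding ph_def using that(2) by (rule Least_le)
    have "L n < L (Suc (ph t))" using ph(1)[of t] that(1) by linarith
    then show "n \<le> ph t" using strict_mono_less[OF Lmono] by auto
  qed
  define S where "S t = as (ph t) ! (t - L (ph t))" for t
  define c where "c t = fold (act A edge_network I) (take (t - L (ph t)) (as (ph t))) (d (ph t))" for t
  have idx: "t - L (ph t) < length (as (ph t))" for t using ph[of t] LS by simp
  have SI: "S t \<in> I" for t unfolding S_def using idx as nth_mem by blast
  have cL: "c (L n) = d n" for n
  proof -
    have "ph (L n) = n" using phI ne LS by simp
    then show ?thesis by (simp add: c_def)
  qed
  \<comment> \<open>The last action of a round needs its own case: there \<open>c (Suc t)\<close> is
    by definition the start of the next round.\<close>
  have cS: "c (Suc t) = act A edge_network I (S t) (c t)" for t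
  proof -
    have 1: "fold (act A edge_network I) (take (Suc t - L (ph t)) (as (ph t))) (d (ph t)) =
        act A edge_network I (S t) (c t)"
      using idx[of t] ph(2)[of t] by (simp add: c_def S_def Suc_diff_le take_Suc_conv_app_nth)
    show ?thesis
    proof (cases "Suc t < L (Suc (ph t))")
      case True
      then have "ph (Suc t) = ph t" using ph(2)[of t] by (intro phI) auto
      then show ?thesis using 1 by (simp add: c_def)
    next
      case False
      then have e: "Suc t = L (Suc (ph t))" using ph(1)[of t] by simp
      then have "take (Suc t - L (ph t)) (as (ph t)) = as (ph t)" by (simp add: LS)
      then show ?thesis using 1 cL[of "Suc (ph t)"] e by (simp add: dS as_def)
    qed
  qed
  have moves: "\<exists>t'\<ge>t. location (c t') a \<noteq> location (c t) a" if aI: "a \<in> I" for a t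
  proof (rule ccontr)
    assume "\<not> ?thesis"
    then have still: "location (c t') a = location (c t) a" if "t \<le> t'" for t' using that by blast
    obtain n where n: "n \<ge> t" "g n = a" using fair[OF aI] by blast
    have "location (d (Suc n)) a \<noteq> location (d n) a"
      using P(2)[OF inid[of n] g[of n]] n(2) by (simp add: dS)
    moreover have "t \<le> L n" "t \<le> L (Suc n)" using n(1) Lge[of n] Lge[of "Suc n"] by linarith+
    ultimately show False using still cL by metis
  qed
  \<comment> \<open>Fairness comes for free: an agent that never acted again would never move
    again.\<close>
  have acts: "\<exists>t'\<ge>t. a \<in> {S t'}" if "a \<in> I" for a t
  proof (rule ccontr)
    assume n: "\<not> ?thesis"
    have "location (c (t + i)) a = location (c t) a" for i
      by (induction i) (use n cS in \<open>auto simp: act_def\<close>)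
    then show False using moves[OF that, of t] by (metis le_Suc_ex)
  qed
  have "c 0 = c0" using cL[of 0] by (simp add: L0 d0)
  moreover have "step A edge_network I {S t} (c t) (c (Suc t))" for t
    unfolding cS by (rule step_act[OF SI])
  ultimately have "execution A edge_network I c"
    unfolding execution_def using ini acts by (auto intro!: exI[of _ "\<lambda>t. {S t}"])
  then show thesis using that moves by blast
qed

text \<open>Any two stuck groups intersect, so a single one of them, which is finite, meets all of
  them. Names outside it form no stuck group and admit a restless execution.\<close>

lemma gossip_not_quiescent:
  assumes A: "self_stabilizing_gossip A" and k: "k \<ge> 1" and l: "l \<ge> 1"
  shows "\<not> quiescent A k l"
proof
  assume q: "quiescent A k l"
  obtain G0 where G0: "finite G0" "\<And>G. stuck A G \<Longrightarrow> G \<inter> G0 \<noteq> {}"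
  proof (cases "\<exists>G0. stuck A G0")
    case True
    then obtain G0 where G: "stuck A G0" by blast
    moreover from G have "finite G0" unfolding stuck_def by blast
    ultimately show thesis using that disjoint_stuck_contradiction[OF A] by blast
  next
    case False
    then show thesis using that[of "{}"] by blast
  qed
  have "infinite (- G0)" using G0(1) by (simp add: Compl_eq_Diff_UNIV)
  then obtain I where I: "I \<subseteq> - G0" "finite I" "card I = k" using infinite_arbitrarily_large by blast
  then have "I \<noteq> {}" using k by auto
  have "\<not> stuck A G" if "G \<subseteq> I" for G using G0(2) that I(1) by blast
  moreover have "initial edge_network I \<lparr>location = (\<lambda>_. 0), state = undefined,
      arrival = (\<lambda>_. None), whiteboard = undefined\<rparr>"
    by (simp add: initial_edge_network_iff)
  ultimately obtain c where c: "execution A edge_network I c"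
    "\<And>a t. a \<in> I \<Longrightarrow> \<exists>t'\<ge>t. location (c t') a \<noteq> location (c t) a"
    using restless_execution[OF _ I(2) \<open>I \<noteq> {}\<close>] by metis
  then obtain t Q where Q: "Q \<subseteq> I" "l \<le> int (card Q)"
    "\<forall>a\<in>Q. \<forall>t'\<ge>t. location (c t') a = location (c t) a"
    using q valid_edge_network I(2,3) unfolding quiescent_def by metis
  then have "Q \<noteq> {}" using l by auto
  then show False using Q(1,3) c(2) by (metis all_not_in_conv subsetD)
qed

subsection \<open>The patrol algorithm\<close>

text \<open>Local distinctness of the labels makes the definite description in
  \<open>neighbour\<close> proper.\<close>

lemma neighbour_link:
  assumes "valid_network N" "u \<in> nodes N" "p \<in> ports N u"
  shows "(u, neighbour N u p) \<in> links N" "label N u (neighbour N u p) = p"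
    "neighbour N u p \<in> nodes N" "neighbour N u p \<noteq> u"
proof -
  have inj: "inj_on (label N u) {v. (u, v) \<in> links N}" using assms unfolding valid_network_def by blast
  obtain v where v: "(u, v) \<in> links N" "label N u v = p" using assms(3) by (auto simp: ports_def)
  have "neighbour N u p = v" unfolding neighbour_def
    by (rule the_equality) (use v inj in \<open>auto dest: inj_onD\<close>)
  then show "(u, neighbour N u p) \<in> links N" "label N u (neighbour N u p) = p"
    "neighbour N u p \<in> nodes N" "neighbour N u p \<noteq> u"
    using v assms(1) unfolding valid_network_def irrefl_def by auto
qed

lemma neighbour_label:
  assumes "valid_network N" "(u, v) \<in> links N"
  shows "label N u v \<in> ports N u" "neighbour N u (label N u v) = v"
proof -
  show p: "label N u v \<in> ports N u" using assms(2) by (auto simp: ports_def)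
  have u: "u \<in> nodes N" using assms unfolding valid_network_def by blast
  then have "inj_on (label N u) {v. (u, v) \<in> links N}" using assms unfolding valid_network_def by blast
  then show "neighbour N u (label N u v) = v"
    using neighbour_link[OF assms(1) u p] assms(2) by (auto dest: inj_onD)
qed

lemma finite_ports: "valid_network N \<Longrightarrow> finite (ports N u)"
  by (rule finite_subset[of _ "label N u ` nodes N"]) (auto simp: ports_def valid_network_def)

text \<open>
  A memory consists of the names retraced so far, the ports still to be taken, and the ports of entry,
  newest first.  A whiteboard is an association list from names to trails and rotors; new entries
  shadow older ones.
\<close>

type_synonym memory = "nat list \<times> nat list \<times> nat list"
type_synonym ledger = "(nat \<times> nat list \<times> nat) list"

section \<open>Slots, rotors and decisions\<close>

definition slot :: "ledger \<Rightarrow> nat \<Rightarrow> nat list \<times> nat" where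
  "slot B j = (case map_of B j of None \<Rightarrow> ([], 0) | Some r \<Rightarrow> r)"

abbreviation trail :: "ledger \<Rightarrow> nat \<Rightarrow> nat list" where "trail B j \<equiv> fst (slot B j)"
abbreviation rotor :: "ledger \<Rightarrow> nat \<Rightarrow> nat" where "rotor B j \<equiv> snd (slot B j)"

lemma slot_Cons: "slot ((i, r) # B) j = (if i = j then r else slot B j)"
  by (simp add: slot_def)

text \<open>Each retrace of \<open>j\<close> adds one copy of \<open>j\<close> to \<open>xs\<close>.
  A trail that no longer grows thus stays fresh only finitely often, whereas a growing one becomes
  fresh again and again.\<close>

definition fresh :: "nat list \<Rightarrow> ledger \<Rightarrow> nat \<Rightarrow> bool" where
  "fresh xs B j \<longleftrightarrow> count_list xs j < length (trail B j)"

text \<open>The rotor is an unbounded counter; its residue selects a port in increasing order of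
  labels.\<close>

definition rotor_port :: "nat set \<Rightarrow> nat \<Rightarrow> nat" where
  "rotor_port P r = sorted_list_of_set P ! (r mod card P)"

text \<open>Every action, a staying one included, pushes the entry port \<open>q\<close> and
  publishes the resulting history. Starting a retrace takes an action without a move, so the copied
  trail is followed from the node where it was read. The least fresh name is below \<open>a\<close>
  as soon as some fresh name is.\<close>

definition decide ::
  "nat \<Rightarrow> nat set \<Rightarrow> nat \<Rightarrow> memory \<Rightarrow> ledger \<Rightarrow> memory \<times> (nat list \<times> nat) \<times> nat option" where
  "decide a P q = (\<lambda>(past, todo, hist) B.
     case todo of
       p # ps \<Rightarrow> ((past, ps, q # hist), (q # hist, rotor B a), Some p)
     | [] \<Rightarrow>
         if \<exists>j<a. fresh past B j then
           let j = (LEAST j. fresh past B j)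
           in ((j # past, trail B j, q # hist), (q # hist, rotor B a), None)
         else ((past, [], q # hist), (q # hist, Suc (rotor B a)), Some (rotor_port P (rotor B a))))"

definition entry_port :: "nat option \<Rightarrow> nat" where
  "entry_port x = (case x of None \<Rightarrow> 0 | Some q \<Rightarrow> q)"

text \<open>The four maps code memories and ledgers in the given state and whiteboard types, with
  \<open>ds\<close> and \<open>dw\<close> decoding.\<close>

definition patrol ::
  "(memory \<Rightarrow> 's) \<Rightarrow> ('s \<Rightarrow> memory) \<Rightarrow> (ledger \<Rightarrow> 'w) \<Rightarrow> ('w \<Rightarrow> ledger) \<Rightarrow> ('s, 'w) algorithm" where
  "patrol es ds ew dw V =
     (let (m, r, d) = decide (own_id V) (port_labels V) (entry_port (in_port V))
            (ds (own_state V)) (dw (board V))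
      in (es m, ew ((own_id V, r) # dw (board V)), d))"

lemma rotor_port_in: "finite P \<Longrightarrow> P \<noteq> {} \<Longrightarrow> rotor_port P r \<in> P"
  unfolding rotor_port_def
  by (metis card_gt_0_iff length_sorted_list_of_set mod_less_divisor nth_mem set_sorted_list_of_set)

lemma rotor_port_surj:
  assumes "finite P" "p \<in> P"
  obtains r where "r \<ge> n" "rotor_port P r = p"
proof -
  obtain k where k: "k < card P" "sorted_list_of_set P ! k = p"
    using assms by (metis in_set_conv_nth length_sorted_list_of_set set_sorted_list_of_set)
  show thesis
  proof
    show "n \<le> n * card P + k" using k(1) by (cases "card P") auto
    show "rotor_port P (n * card P + k) = p" using k by (simp add: rotor_port_def)
  qed
qed

lemma eventually_constant_nat:
  fixes f :: "nat \<Rightarrow> nat"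
  assumes "\<And>t. f (Suc t) \<le> f t"
  obtains t0 where "\<And>t. t \<ge> t0 \<Longrightarrow> f (Suc t) = f t"
proof -
  have anti: "t \<le> t' \<Longrightarrow> f t' \<le> f t" for t t' using lift_Suc_antimono_le[of f] assms by blast
  obtain t0 where t0: "\<And>t. f t0 \<le> f t" using ex_has_least_nat[of "\<lambda>_. True" _ f] by blast
  show thesis
  proof
    fix t assume "t \<ge> t0"
    then show "f (Suc t) = f t" using anti[of t0 t] t0[of "Suc t"] assms[of t] by simp
  qed
qed

section \<open>Executions of the patrol algorithm\<close>

text \<open>The last assumption rules out the network with a single node, where gossip is
  immediate.\<close>

locale patrol_run =
  fixes es :: "memory \<Rightarrow> 's" and ds :: "'s \<Rightarrow> memory" and ew :: "ledger \<Rightarrow> 'w" and dw :: "'w \<Rightarrow> ledger"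
    and N :: network and I :: "nat set" and c :: "nat \<Rightarrow> ('s, 'w) config" and S :: "nat \<Rightarrow> nat set"
  assumes ds: "ds (es x) = x" and dw: "dw (ew y) = y"
    and valid: "valid_network N"
    and initial: "initial N I (c 0)"
    and step: "step (patrol es ds ew dw) N I (S t) (c t) (c (Suc t))"
    and fair: "a \<in> I \<Longrightarrow> \<exists>t'\<ge>t. a \<in> S t'"
    and ports_nonempty: "u \<in> nodes N \<Longrightarrow> ports N u \<noteq> {}"
begin

definition loc where "loc t a = location (c t) a"
definition past where "past t a = fst (ds (state (c t) a))"
definition todo where "todo t a = fst (snd (ds (state (c t) a)))"
definition hist where "hist t a = snd (snd (ds (state (c t) a)))"
definition brd where "brd t v = dw (whiteboard (c t) v)"
definition inp where "inp t a = entry_port (arrival (c t) a)"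
definition dcs where
  "dcs t a = decide a (ports N (loc t a)) (inp t a) (past t a, todo t a, hist t a) (brd t (loc t a))"

lemma S_subset: "S t \<subseteq> I" using step[of t] unfolding step_def by blast

lemma patrol_view:
  "patrol es ds ew dw (view_of N I (c t) a) =
     (es (fst (dcs t a)), ew ((a, fst (snd (dcs t a))) # brd t (loc t a)), snd (snd (dcs t a)))"
  by (simp add: patrol_def view_of_def dcs_def loc_def past_def todo_def hist_def brd_def inp_def
      case_prod_unfold Let_def)

lemma memory_acting:
  assumes "a \<in> S t"
  shows "(past (Suc t) a, todo (Suc t) a, hist (Suc t) a) = fst (dcs t a)"
  using step[of t] assms
  by (simp add: step_def past_def todo_def hist_def new_state_def patrol_view ds)

lemma loc_acting:
  assumes "a \<in> S t"
  shows "loc (Suc t) a = (case snd (snd (dcs t a)) of None \<Rightarrow> loc t a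
    | Some p \<Rightarrow> if p \<in> ports N (loc t a) then neighbour N (loc t a) p else loc t a)"
  using step[of t] assms
  by (simp add: step_def destination_def patrol_view loc_def[symmetric] split: option.split)

lemma loc_Suc: "a \<in> S t \<Longrightarrow> loc (Suc t) a = destination (patrol es ds ew dw) N I (c t) a"
  using step[of t] by (simp add: step_def loc_def)

lemma idle:
  assumes "a \<notin> S t"
  shows "loc (Suc t) a = loc t a" "past (Suc t) a = past t a" "todo (Suc t) a = todo t a"
    "hist (Suc t) a = hist t a" "inp (Suc t) a = inp t a"
  using step[of t] assms
  by (simp_all add: step_def loc_def past_def todo_def hist_def inp_def)

lemma brd_acting:
  assumes "a \<in> S t"
  shows "brd (Suc t) (loc t a) = (a, fst (snd (dcs t a))) # brd t (loc t a)"
  using step[of t] assms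
  by (simp add: step_def brd_def loc_def new_board_def patrol_view dw)

text \<open>An agent adds entries under its own name only, and only at the node where it acts;
  entries of others do not shadow this slot.\<close>

lemma slot_unchanged:
  assumes "\<not> (a \<in> S t \<and> loc t a = v)"
  shows "slot (brd (Suc t) v) a = slot (brd t v) a"
proof (cases "v \<in> loc t ` S t")
  case True
  then show ?thesis using brd_acting assms by (auto simp: slot_Cons)
next
  case False
  then have "whiteboard (c (Suc t)) v = whiteboard (c t) v"
    using step[of t] unfolding step_def loc_def by blast
  then show ?thesis by (simp add: brd_def)
qed

lemma hist_acting: "a \<in> S t \<Longrightarrow> hist (Suc t) a = inp t a # hist t a"
  and trail_acting: "a \<in> S t \<Longrightarrow> trail (brd (Suc t) (loc t a)) a = hist (Suc t) a"
proof -
  assume a: "a \<in> S t"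
  show h: "hist (Suc t) a = inp t a # hist t a"
    using memory_acting[OF a] by (auto simp: dcs_def decide_def Let_def split: list.splits if_splits)
  show "trail (brd (Suc t) (loc t a)) a = hist (Suc t) a"
    unfolding h brd_acting[OF a]
    by (auto simp: slot_Cons dcs_def decide_def Let_def split: list.splits)
qed

definition starts where
  "starts t a j \<longleftrightarrow> a \<in> S t \<and> todo t a = [] \<and> (\<exists>i<a. fresh (past t a) (brd t (loc t a)) i) \<and>
     j = (LEAST j. fresh (past t a) (brd t (loc t a)) j)"

lemma follow:
  assumes "a \<in> S t" "todo t a = p # ps"
  shows "todo (Suc t) a = ps" "past (Suc t) a = past t a"
    "loc (Suc t) a = (if p \<in> ports N (loc t a) then neighbour N (loc t a) p else loc t a)"
  using memory_acting[OF assms(1)] loc_acting[OF assms(1)] assms(2)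
  by (simp_all add: dcs_def decide_def)

lemma start:
  assumes "starts t a j"
  shows "todo (Suc t) a = trail (brd t (loc t a)) j" "past (Suc t) a = j # past t a"
    "loc (Suc t) a = loc t a" "fresh (past t a) (brd t (loc t a)) j" "j < a"
proof -
  have a: "a \<in> S t" "todo t a = []" and ex: "\<exists>i<a. fresh (past t a) (brd t (loc t a)) i"
    and j: "j = (LEAST j. fresh (past t a) (brd t (loc t a)) j)"
    using assms unfolding starts_def by blast+
  show "todo (Suc t) a = trail (brd t (loc t a)) j" "past (Suc t) a = j # past t a"
    "loc (Suc t) a = loc t a"
    using memory_acting[OF a(1)] loc_acting[OF a(1)] a(2) ex j
    by (simp_all add: dcs_def decide_def Let_def)
  obtain i where i: "i < a" "fresh (past t a) (brd t (loc t a)) i" using ex by blast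
  show "fresh (past t a) (brd t (loc t a)) j" unfolding j using i(2) by (rule LeastI)
  show "j < a" unfolding j using Least_le[of "fresh (past t a) (brd t (loc t a))", OF i(2)] i(1) by simp
qed

lemma rotate:
  assumes "a \<in> S t" "todo t a = []" "\<not> (\<exists>j<a. fresh (past t a) (brd t (loc t a)) j)" "loc t a \<in> nodes N"
  shows "todo (Suc t) a = []" "past (Suc t) a = past t a"
    "loc (Suc t) a = neighbour N (loc t a) (rotor_port (ports N (loc t a)) (rotor (brd t (loc t a)) a))"
    "rotor (brd (Suc t) (loc t a)) a = Suc (rotor (brd t (loc t a)) a)"
  using memory_acting[OF assms(1)] loc_acting[OF assms(1)] brd_acting[OF assms(1)] assms(2,3)
    rotor_port_in[OF finite_ports[OF valid] ports_nonempty[OF assms(4)]]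
  by (simp_all add: dcs_def decide_def slot_Cons)

lemma no_start_past:
  assumes "\<And>j. \<not> starts t a j"
  shows "past (Suc t) a = past t a"
proof (cases "a \<in> S t")
  case True
  show ?thesis
  proof (cases "todo t a")
    case Nil
    then have "\<not> (\<exists>i<a. fresh (past t a) (brd t (loc t a)) i)" using True assms unfolding starts_def by blast
    then show ?thesis using memory_acting[OF True] Nil
      by (auto simp: dcs_def decide_def Let_def split: if_splits)
  next
    case (Cons p ps)
    then show ?thesis using follow(2) True by blast
  qed
next
  case False
  then show ?thesis by (rule idle)
qed

lemma loc_in_nodes: "a \<in> I \<Longrightarrow> loc t a \<in> nodes N"
proof (induction t)
  case 0
  then show ?case using initial unfolding initial_def loc_def by blast
next
  case (Suc t)
  then show ?case
    using idle(1)[of a t] loc_acting[of a t] neighbour_link(3)[OF valid]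
    by (cases "a \<in> S t") (auto split: option.split)
qed

lemma inp_moving:
  assumes "a \<in> S t" "loc (Suc t) a \<noteq> loc t a"
  shows "inp (Suc t) a = label N (loc (Suc t) a) (loc t a)"
proof -
  have "arrival (c (Suc t)) a = new_arrival (patrol es ds ew dw) N I (c t) a"
    using step[of t] assms(1) by (simp add: step_def)
  then show ?thesis
    using loc_Suc[OF assms(1)] assms(2) by (simp add: inp_def new_arrival_def loc_def entry_port_def)
qed

lemma idle_until:
  assumes "t \<le> t'" "\<And>s. t \<le> s \<Longrightarrow> s < t' \<Longrightarrow> a \<notin> S s"
  shows "todo t' a = todo t a"
  using assms
proof (induction t' rule: dec_induct)
  case (step n)
  then show ?case using idle(3)[of a n] by simp
qed simp

lemma next_action:
  assumes "a \<in> I"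
  obtains t' where "t' \<ge> t" "a \<in> S t'" "\<And>s. t \<le> s \<Longrightarrow> s < t' \<Longrightarrow> a \<notin> S s"
proof -
  let ?P = "\<lambda>t'. t \<le> t' \<and> a \<in> S t'"
  have "?P (LEAST t'. ?P t')" using fair[OF assms, of t] by (metis (mono_tags, lifting) LeastI)
  then show thesis using that[of "LEAST t'. ?P t'"] not_less_Least[of _ ?P] by blast
qed

text \<open>Every action with pending ports consumes one of them, so the list runs empty.\<close>

lemma decision_recurs:
  assumes "a \<in> I"
  shows "\<exists>t'\<ge>t. a \<in> S t' \<and> todo t' a = []"
proof (induction "length (todo t a)" arbitrary: t)
  case 0
  obtain t' where t': "t' \<ge> t" "a \<in> S t'" "\<And>s. t \<le> s \<Longrightarrow> s < t' \<Longrightarrow> a \<notin> S s"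
    using next_action[OF assms, of t] by blast
  then show ?case using idle_until[OF t'(1,3)] 0 by auto
next
  case (Suc n)
  obtain t' where t': "t' \<ge> t" "a \<in> S t'" "\<And>s. t \<le> s \<Longrightarrow> s < t' \<Longrightarrow> a \<notin> S s"
    using next_action[OF assms, of t] by blast
  obtain p ps where p: "todo t a = p # ps" using Suc(2) by (cases "todo t a") auto
  then have "n = length (todo (Suc t') a)" using follow(1)[of a t'] t' idle_until[OF t'(1,3)] Suc(2) by simp
  from Suc(1)[OF this] show ?case using t'(1) by (meson Suc_leD le_trans)
qed

section \<open>Absent names and the least agent\<close>

text \<open>Slots of absent names never change, so their trails have bounded length, while every
  start raises the corresponding count in \<open>past\<close>.\<close>

lemma phantom_starts_stop:
  assumes a: "a \<in> I" and b: "\<And>j. j < b \<Longrightarrow> j \<notin> I"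
  obtains t1 where "\<And>t j. t \<ge> t1 \<Longrightarrow> j < b \<Longrightarrow> \<not> starts t a j"
proof -
  have const: "slot (brd t v) j = slot (brd 0 v) j" if "j < b" for t v j
  proof (induction t)
    case (Suc t)
    have "j \<notin> S t" using S_subset b[OF that] by blast
    then show ?case using slot_unchanged[of j t v] Suc by simp
  qed simp
  have "finite ((\<lambda>(v, j). length (trail (brd 0 v) j)) ` (nodes N \<times> {..<b}))"
    using valid by (simp add: valid_network_def)
  then obtain B where "\<forall>n \<in> (\<lambda>(v, j). length (trail (brd 0 v) j)) ` (nodes N \<times> {..<b}). n \<le> B"
    using finite_nat_set_iff_bounded_le by blast
  then have B: "length (trail (brd t v) j) \<le> B" if "v \<in> nodes N" "j < b" for t v j
    using that const[of j t v] by auto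
  \<comment> \<open>The number of phantom starts still possible: it never increases, and it drops at
    each start of a name below \<open>b\<close> because freshness keeps the count below
    \<open>B\<close>.\<close>
  define \<Phi> where "\<Phi> t = (\<Sum>j<b. B - count_list (past t a) j)" for t
  have dec: "\<Phi> (Suc t) \<le> \<Phi> t" for t
  proof (cases "\<exists>j. starts t a j")
    case True
    then show ?thesis using start(2) unfolding \<Phi>_def by (intro sum_mono) auto
  next
    case False
    then show ?thesis using no_start_past[of t a] by (simp add: \<Phi>_def)
  qed
  have less: "\<Phi> (Suc t) < \<Phi> t" if st: "starts t a j" and j: "j < b" for t j
  proof -
    have "count_list (past t a) j < B"
      using start(4)[OF st] B[OF loc_in_nodes[OF a] j, of t t] unfolding fresh_def by simp
    then show ?thesis unfolding \<Phi>_def using j start(2)[OF st]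
      by (intro sum_strict_mono_ex1) (auto intro!: bexI[of _ j])
  qed
  obtain t1 where "\<And>t. t \<ge> t1 \<Longrightarrow> \<Phi> (Suc t) = \<Phi> t" using eventually_constant_nat[of \<Phi>] dec by blast
  then show thesis using that[of t1] less by (metis less_irrefl)
qed

text \<open>All names that \<open>m\<close> could retrace are absent, so its starts come to an end.
  Once its pending ports are used up, it only follows its rotors.\<close>

lemma least_agent_settles:
  assumes m: "m \<in> I" and least: "\<And>j. j < m \<Longrightarrow> j \<notin> I"
  obtains t0 where "\<And>t. t \<ge> t0 \<Longrightarrow> todo t m = []"
    "\<And>t. t \<ge> t0 \<Longrightarrow> m \<in> S t \<Longrightarrow> \<not> (\<exists>j<m. fresh (past t m) (brd t (loc t m)) j)"
proof -
  obtain t1 where t1: "\<And>t j. t \<ge> t1 \<Longrightarrow> j < m \<Longrightarrow> \<not> starts t m j"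
    using phantom_starts_stop[OF m, of m] least by blast
  obtain t0 where t0: "t0 \<ge> t1" "m \<in> S t0" "todo t0 m = []" using decision_recurs[OF m] by blast
  have nf: "\<not> (\<exists>j<m. fresh (past t m) (brd t (loc t m)) j)" if "t \<ge> t1" "m \<in> S t" "todo t m = []" for t
    using that t1[of t] start(5)[of t m] unfolding starts_def by blast
  have td: "todo t m = []" if "t \<ge> t0" for t using that
  proof (induction t rule: dec_induct)
    case (step t)
    then show ?case
      using rotate(1)[of m t] nf[of t] t0(1) loc_in_nodes[OF m] idle(3)[of m t] by (cases "m \<in> S t") auto
  qed (fact t0(3))
  then show thesis using that[of t0] nf t0(1) by simp
qed

end

section \<open>The rotor walk of the least agent\<close>

locale patrol_settled = patrol_run +
  fixes m t0
  assumes m: "m \<in> I" and least: "j < m \<Longrightarrow> j \<notin> I"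
    and todo_m: "t \<ge> t0 \<Longrightarrow> todo t m = []"
    and not_fresh_m: "t \<ge> t0 \<Longrightarrow> m \<in> S t \<Longrightarrow> \<not> (\<exists>j<m. fresh (past t m) (brd t (loc t m)) j)"
begin

text \<open>From \<open>t0\<close> on every action of \<open>m\<close> is a move, so this count is
  the index of \<open>m\<close> on its walk.\<close>

definition idx where "idx t = (\<Sum>s=t0..<t. if m \<in> S s then 1 else 0 :: nat)"

lemma idx_Suc: "t \<ge> t0 \<Longrightarrow> idx (Suc t) = (if m \<in> S t then Suc (idx t) else idx t)"
  by (simp add: idx_def)

lemma idx_mono: "t \<le> t' \<Longrightarrow> idx t \<le> idx t'"
  unfolding idx_def by (intro sum_mono2) auto

lemma idx_unbounded: "\<exists>t\<ge>t0. idx t \<ge> n"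
proof (induction n)
  case (Suc n)
  then obtain t where t: "t \<ge> t0" "idx t \<ge> n" by blast
  obtain t' where t': "t' \<ge> t" "m \<in> S t'" using fair[OF m] by blast
  then have "idx (Suc t') \<ge> Suc n" using idx_Suc[of t'] idx_mono[of t t'] t by simp
  then show ?case using t t' by (meson le_SucI le_trans)
qed auto

definition rotor_step where
  "rotor_step = (\<lambda>(u, R). (neighbour N u (rotor_port (ports N u) (R u)), R(u := Suc (R u))))"

text \<open>The walk is indexed by actions of \<open>m\<close> rather than by time, which makes it
  independent of the schedule.\<close>

definition trj where "trj i = (rotor_step ^^ i) (loc t0 m, \<lambda>v. rotor (brd t0 v) m)"
definition pos where "pos i = fst (trj i)"
definition rot where "rot i = snd (trj i)"

lemma pos_Suc: "pos (Suc i) = neighbour N (pos i) (rotor_port (ports N (pos i)) (rot i (pos i)))"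
  and rot_Suc: "rot (Suc i) = (rot i)(pos i := Suc (rot i (pos i)))"
  by (simp_all add: pos_def rot_def trj_def rotor_step_def case_prod_unfold)

lemma trajectory:
  assumes "t \<ge> t0"
  shows "loc t m = pos (idx t) \<and> (\<forall>v. rotor (brd t v) m = rot (idx t) v)"
  using assms
proof (induction t rule: dec_induct)
  case base
  then show ?case by (simp add: idx_def pos_def rot_def trj_def)
next
  case (step t)
  show ?case
  proof (cases "m \<in> S t")
    case True
    note r = rotate[OF True todo_m[OF step(1)] not_fresh_m[OF step(1) True] loc_in_nodes[OF m]]
    have "rotor (brd (Suc t) v) m = rot (Suc (idx t)) v" for v
      using r(4) step.IH slot_unchanged[of m t v] by (cases "v = loc t m") (auto simp: rot_Suc)
    then show ?thesis using r(3) step.IH True by (simp add: idx_Suc[OF step(1)] pos_Suc)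
  next
    case False
    then show ?thesis using step.IH idle(1)[OF False] slot_unchanged[of m t]
      by (simp add: idx_Suc[OF step(1)])
  qed
qed

lemma pos_in_nodes: "pos i \<in> nodes N"
proof -
  have "pos 0 \<in> nodes N" using loc_in_nodes[OF m] by (simp add: pos_def trj_def)
  then show ?thesis
    by (induction i) (auto simp: pos_Suc intro!: neighbour_link(3)[OF valid]
        rotor_port_in finite_ports[OF valid] ports_nonempty)
qed

lemma pos_link: "(pos i, pos (Suc i)) \<in> links N" "(pos (Suc i), pos i) \<in> links N"
proof -
  show "(pos i, pos (Suc i)) \<in> links N" unfolding pos_Suc
    by (intro neighbour_link(1)[OF valid] pos_in_nodes rotor_port_in finite_ports[OF valid] ports_nonempty)
  then show "(pos (Suc i), pos i) \<in> links N"
    using valid unfolding valid_network_def by (meson symD)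
qed

definition ent where "ent i = (case i of 0 \<Rightarrow> inp t0 m | Suc j \<Rightarrow> label N (pos i) (pos j))"
text \<open>The history of \<open>m\<close> after \<open>n\<close> actions. The head of
  \<open>H (Suc s)\<close> is \<open>ent s\<close>, which for \<open>s > 0\<close> is the port
  leading from \<open>pos s\<close> back to \<open>pos (s - 1)\<close>; read from
  \<open>pos s\<close>, the list retraces the walk backwards.\<close>

definition H where "H n = rev (map ent [0..<n]) @ hist t0 m"

lemma H_Suc: "H (Suc n) = ent n # H n" by (simp add: H_def)

lemma length_H: "n \<le> length (H n)" by (simp add: H_def)

lemma inp_hist_m:
  assumes "t \<ge> t0"
  shows "inp t m = ent (idx t) \<and> hist t m = H (idx t)"
  using assms
proof (induction t rule: dec_induct)
  case base
  then show ?case by (simp add: idx_def ent_def H_def)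
next
  case (step t)
  show ?case
  proof (cases "m \<in> S t")
    case True
    have i: "idx (Suc t) = Suc (idx t)" using True by (simp add: idx_Suc[OF step(1)])
    have l: "loc t m = pos (idx t)" "loc (Suc t) m = pos (Suc (idx t))"
      using trajectory[OF step(1)] trajectory[of "Suc t"] step(1) i by auto
    \<comment> \<open>Only a genuine change of node renews the arrival label; it is one because
      links are irreflexive.\<close>
    have "loc (Suc t) m \<noteq> loc t m"
      using pos_link[of "idx t"] valid unfolding l valid_network_def irrefl_def by metis
    from inp_moving[OF True this] show ?thesis
      using hist_acting[OF True] step.IH by (simp add: i H_Suc l) (simp add: ent_def)
  next
    case False
    then show ?thesis using step.IH idle[OF False] by (simp add: idx_Suc[OF step(1)])
  qed
qed

text \<open>The slot of \<open>m\<close> at a node is rewritten at each visit and untouched in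
  between, so it holds the history as of the latest visit \<open>s\<close>.\<close>

lemma trail_m:
  assumes "t \<ge> t0" "i < idx t"
  shows "\<exists>s. i \<le> s \<and> s < idx t \<and> pos s = pos i \<and> trail (brd t (pos i)) m = H (Suc s)"
  using assms
proof (induction t rule: dec_induct)
  case base
  then show ?case by (simp add: idx_def)
next
  case (step t)
  note tr = trajectory[OF step(1)]
  show ?case
  proof (cases "m \<in> S t")
    case True
    have i: "idx (Suc t) = Suc (idx t)" using True by (simp add: idx_Suc[OF step(1)])
    show ?thesis
    proof (cases "pos i = pos (idx t)")
      case eq: True
      have "trail (brd (Suc t) (loc t m)) m = H (Suc (idx t))"
        using trail_acting[OF True] inp_hist_m[of "Suc t"] step(1) i by simp
      then show ?thesis using tr eq step.prems i by (intro exI[of _ "idx t"]) auto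
    next
      case False
      then have "i < idx t" using step.prems i by (metis less_SucE)
      moreover have "slot (brd (Suc t) (pos i)) m = slot (brd t (pos i)) m"
        using False tr by (intro slot_unchanged) auto
      ultimately show ?thesis using step.IH i by (metis less_SucI)
    qed
  next
    case False
    then show ?thesis using step.IH step.prems slot_unchanged[of m t]
      by (simp add: idx_Suc[OF step(1)])
  qed
qed

section \<open>Periodicity and coverage of the walk\<close>

text \<open>The walk depends on the rotors only modulo the degrees. Position and residues form a
  deterministic system with finitely many states, which must repeat.\<close>

lemma pos_periodic:
  obtains i0 T where "T > 0" "\<And>i. i \<ge> i0 \<Longrightarrow> pos (i + T) = pos i"
proof -
  \<comment> \<open>The value 0 outside the network keeps the range of \<open>G\<close>
    finite.\<close>
  define G where "G i = (pos i, \<lambda>v. if v \<in> nodes N then rot i v mod card (ports N v) else 0)" for i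
  have fin: "finite (nodes N)" using valid unfolding valid_network_def by blast
  define D where "D = (\<Sum>v\<in>nodes N. card (ports N v))"
  have "rot i v mod card (ports N v) \<le> D" if "v \<in> nodes N" for i v
  proof -
    have "card (ports N v) > 0"
      using finite_ports[OF valid] ports_nonempty[OF that] by (simp add: card_gt_0_iff)
    then have "rot i v mod card (ports N v) \<le> card (ports N v)" by (simp add: less_imp_le)
    also have "\<dots> \<le> D" unfolding D_def using fin that by (intro member_le_sum) auto
    finally show ?thesis .
  qed
  then have "range G \<subseteq> nodes N \<times> {f. \<forall>v. (v \<in> nodes N \<longrightarrow> f v \<in> {..D}) \<and> (v \<notin> nodes N \<longrightarrow> f v = 0)}"
    using pos_in_nodes by (auto simp: G_def)
  then have "finite (range G)"
    by (rule finite_subset) (intro finite_cartesian_product fin finite_set_of_finite_funs finite_atMost)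
  then have "\<not> inj G" using finite_imageD infinite_UNIV_nat by blast
  then obtain i0 i1 where i: "i0 < i1" "G i0 = G i1" unfolding inj_def by (metis linorder_neqE_nat)
  have det: "G (Suc i) = G (Suc j)" if "G i = G j" for i j
  proof -
    have p: "pos i = pos j" and r: "rot i v mod card (ports N v) = rot j v mod card (ports N v)"
      if "v \<in> nodes N" for v
      using that \<open>G i = G j\<close> by (auto simp: G_def dest: fun_cong[of _ _ v])
    note p = p[OF pos_in_nodes]
    have "pos (Suc i) = pos (Suc j)"
      using r[OF pos_in_nodes[of j]] by (simp add: pos_Suc p rotor_port_def)
    moreover have "rot (Suc i) v mod card (ports N v) = rot (Suc j) v mod card (ports N v)"
      if "v \<in> nodes N" for v
      using mod_Suc_eq r[OF that] by (cases "v = pos j") (simp_all add: rot_Suc p, metis mod_Suc_eq)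
    ultimately show ?thesis by (auto simp: G_def)
  qed
  have "G (i0 + n) = G (i1 + n)" for n
  proof (induction n)
    case (Suc n)
    then show ?case using det[of "i0 + n"] by simp
  qed (simp add: i)
  then have eq: "pos (i0 + n) = pos (i1 + n)" for n by (simp add: G_def)
  show thesis
  proof
    show "i1 - i0 > 0" using i by simp
    fix i assume "i \<ge> i0"
    then show "pos (i + (i1 - i0)) = pos i"
      using eq[of "i - i0"] i(1) by (simp add: add.commute)
  qed
qed

text \<open>The rotor at \<open>v\<close> advances by exactly one per visit, so under infinitely
  many visits it skips no value.\<close>

lemma rotor_values:
  assumes "\<And>n. \<exists>i\<ge>n. pos i = v" "r \<ge> rot n v"
  shows "\<exists>i\<ge>n. pos i = v \<and> rot i v = r"
proof -
  have nxt: "\<exists>i\<ge>k. pos i = v \<and> rot i v = rot k v" for k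
  proof -
    let ?P = "\<lambda>i. k \<le> i \<and> pos i = v"
    let ?i = "LEAST i. ?P i"
    have P: "?P ?i" using assms(1)[of k] by (metis (mono_tags, lifting) LeastI)
    have "rot j v = rot k v" if "k \<le> j" "j \<le> ?i" for j using that
    proof (induction j rule: dec_induct)
      case (step j)
      then have "\<not> ?P j" by (intro not_less_Least) simp
      then show ?case using step by (simp add: rot_Suc)
    qed simp
    then show ?thesis using P by blast
  qed
  show ?thesis using assms(2)
  proof (induction r rule: dec_induct)
    case base
    show ?case by (rule nxt)
  next
    case (step r)
    then obtain i where i: "i \<ge> n" "pos i = v" "rot i v = r" by blast
    then have "rot (Suc i) v = Suc r" by (simp add: rot_Suc)
    then show ?case using nxt[of "Suc i"] i(1) by (metis Suc_leD le_trans)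
  qed
qed

text \<open>Some node is visited infinitely often by periodicity. The rotor of such a node points to
  each port again and again, so all neighbours are visited infinitely often too; connectivity does
  the rest.\<close>

lemma covers:
  assumes "v \<in> nodes N"
  shows "\<exists>i\<ge>n. pos i = v"
proof -
  obtain i0 T where T: "T > 0" "\<And>i. i \<ge> i0 \<Longrightarrow> pos (i + T) = pos i" using pos_periodic by blast
  have per: "pos (i0 + n * T) = pos i0" for n
  proof (induction n)
    case (Suc n)
    then show ?case using T(2)[of "i0 + n * T"] by (simp add: algebra_simps)
  qed simp
  have "(pos i0, v) \<in> (links N)\<^sup>*" using valid assms pos_in_nodes unfolding valid_network_def by blast
  then show ?thesis
  proof (induction arbitrary: n rule: rtrancl_induct)
    case base
    have "n \<le> i0 + n * T" using T(1) by (simp add: trans_le_add2)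
    then show ?case using per by blast
  next
    case (step u w)
    have u: "u \<in> nodes N" using step(2) valid unfolding valid_network_def by blast
    note p = neighbour_label[OF valid step(2)]
    obtain r where r: "r \<ge> rot n u" "rotor_port (ports N u) r = label N u w"
      using rotor_port_surj[OF finite_ports[OF valid] p(1)] by blast
    obtain i where "i \<ge> n" "pos i = u" "rot i u = r" using rotor_values[OF step.IH r(1)] by blast
    then have "pos (Suc i) = w" "Suc i \<ge> n" using r(2) p(2) by (simp_all add: pos_Suc)
    then show ?case by blast
  qed
qed

text \<open>Wait until every node has been visited at some index \<open>K\<close> or later; from
  then on all trails date from such visits.\<close>

lemma trails_grow:
  obtains t1 where "t1 \<ge> t0" "\<And>t v. t \<ge> t1 \<Longrightarrow> v \<in> nodes N \<Longrightarrow>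
    \<exists>s. K \<le> s \<and> s < idx t \<and> pos s = v \<and> trail (brd t v) m = H (Suc s)"
proof -
  obtain f where f: "\<And>v. v \<in> nodes N \<Longrightarrow> f v \<ge> K \<and> pos (f v) = v" using covers[of _ K] by metis
  have "finite (f ` nodes N)" using valid by (simp add: valid_network_def)
  then obtain M where M: "\<And>v. v \<in> nodes N \<Longrightarrow> f v \<le> M" using finite_nat_set_iff_bounded_le by auto
  obtain t1 where t1: "t1 \<ge> t0" "idx t1 \<ge> Suc M" using idx_unbounded by blast
  show thesis
  proof
    show "t1 \<ge> t0" by (fact t1)
    fix t v assume t: "t \<ge> t1" and v: "v \<in> nodes N"
    have "f v < idx t" using M[OF v] t1(2) idx_mono[OF t] by simp
    then show "\<exists>s. K \<le> s \<and> s < idx t \<and> pos s = v \<and> trail (brd t v) m = H (Suc s)"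
      using trail_m[of t "f v"] f[OF v] t t1(1) by (metis le_trans)
  qed
qed

section \<open>Retracing the least agent until it is met\<close>

text \<open>Otherwise the count of \<open>m\<close> in the past of \<open>b\<close> would freeze
  while the trails of \<open>m\<close> outgrow it everywhere. At a late decision of
  \<open>b\<close>, when starts for absent smaller names are over, \<open>m\<close> would be the
  least fresh name.\<close>

lemma starts_recur:
  assumes b: "b \<in> I" "b \<noteq> m"
  shows "\<exists>t\<ge>t1. starts t b m"
proof (rule ccontr)
  assume "\<not> ?thesis"
  then have none: "\<not> starts t b m" if "t \<ge> t1" for t using that by blast
  have mb: "m < b" using b least by (metis linorder_neqE_nat)
  obtain t2 where t2: "\<And>t j. t \<ge> t2 \<Longrightarrow> j < m \<Longrightarrow> \<not> starts t b j"
    using phantom_starts_stop[OF b(1), of m] least by blast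
  have const: "count_list (past t b) m = count_list (past t1 b) m" if "t \<ge> t1" for t using that
  proof (induction t rule: dec_induct)
    case (step t)
    show ?case
    proof (cases "\<exists>j. starts t b j")
      case True
      then obtain j where j: "starts t b j" by blast
      then have "j \<noteq> m" using none step(1) by blast
      then show ?thesis using start(2)[OF j] step.IH by simp
    next
      case False
      then show ?thesis using no_start_past[of t b] step.IH by simp
    qed
  qed simp
  obtain t3 where t3: "\<And>t v. t \<ge> t3 \<Longrightarrow> v \<in> nodes N \<Longrightarrow>
      \<exists>s. count_list (past t1 b) m \<le> s \<and> s < idx t \<and> pos s = v \<and> trail (brd t v) m = H (Suc s)"
    using trails_grow[of "count_list (past t1 b) m"] by metis
  obtain t where t: "t \<ge> max t1 (max t2 t3)" "b \<in> S t" "todo t b = []" using decision_recurs[OF b(1)] by blast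
  obtain s where s: "count_list (past t1 b) m \<le> s" "trail (brd t (loc t b)) m = H (Suc s)"
    using t3[OF _ loc_in_nodes[OF b(1)], of t t] t(1) by auto
  have fr: "fresh (past t b) (brd t (loc t b)) m"
    using const[of t] t(1) s length_H[of "Suc s"] unfolding fresh_def by simp
  define j where "j = (LEAST j. fresh (past t b) (brd t (loc t b)) j)"
  have "starts t b j" using fr mb t(2,3) unfolding starts_def j_def by blast
  moreover have "j \<le> m" unfolding j_def using fr by (rule Least_le)
  ultimately show False using t2[of t j] none[of t] t(1) by (cases "j = m") auto
qed

lemma meets:
  assumes b: "b \<in> I"
  shows "\<exists>t\<ge>t1. loc t b = loc t m"
proof (rule ccontr)
  assume "\<not> ?thesis"
  then have apart: "loc t b \<noteq> loc t m" if "t \<ge> t1" for t using that by blast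
  then have bm: "b \<noteq> m" by blast
  obtain i0 T where T: "T > 0" "\<And>i. i \<ge> i0 \<Longrightarrow> pos (i + T) = pos i" using pos_periodic by blast
  have per: "pos (y + n * T) = pos y" if "y \<ge> i0" for y n
  proof (induction n)
    case (Suc n)
    then show ?case using T(2)[of "y + n * T"] that by (simp add: algebra_simps)
  qed simp
  \<comment> \<open>The margin of one period \<open>T\<close> above \<open>i0\<close> keeps the
    chase within the periodic part of the walk.\<close>
  obtain t2 where t2: "t2 \<ge> t0" "\<And>t v. t \<ge> t2 \<Longrightarrow> v \<in> nodes N \<Longrightarrow>
      \<exists>s. i0 + T \<le> s \<and> s < idx t \<and> pos s = v \<and> trail (brd t v) m = H (Suc s)"
    using trails_grow[of "i0 + T"] by metis
  obtain ts where ts: "ts \<ge> max t1 t2" "starts ts b m" using starts_recur[OF b bm] by blast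
  obtain s where s: "i0 + T \<le> s" "s < idx ts" "pos s = loc ts b" "trail (brd ts (loc ts b)) m = H (Suc s)"
    using t2(2)[OF _ loc_in_nodes[OF b], of ts ts] ts(1) by auto
  \<comment> \<open>The number of full periods by which \<open>m\<close> leads when the retrace
    begins.\<close>
  define k where "k = (idx (Suc ts) - s) div T"
  \<comment> \<open>Agent \<open>b\<close> is at index \<open>y\<close> with the rest of the trail
    ahead, and the lead \<open>idx t - y\<close> lies strictly between two consecutive multiples of
    \<open>T\<close>, at which the agents would share a node.\<close>
  define chase where "chase t y \<longleftrightarrow> loc t b = pos y \<and> todo t b = H (Suc y) \<and>
    y + k * T < idx t \<and> idx t < y + Suc k * T" for t y
  \<comment> \<open>The lead stays below \<open>Suc k * T\<close> and \<open>idx\<close> never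
    decreases, so \<open>y\<close> cannot fall a full period below \<open>s\<close>.\<close>
  have big: "y > i0" if "chase t y" "t > ts" for t y
  proof -
    have "k * T \<le> idx (Suc ts) - s" unfolding k_def by (rule div_times_less_eq_dividend)
    then have "s + k * T \<le> idx (Suc ts)" using s(2) idx_mono[of ts "Suc ts"] by simp
    moreover have "idx (Suc ts) \<le> idx t" using that(2) by (intro idx_mono) simp
    ultimately show ?thesis using that(1) s(1) unfolding chase_def by simp
  qed
  have locm: "loc t m = pos (idx t)" if "t \<ge> ts" for t using trajectory[of t] that ts(1) t2(1) by simp
  have noteq: "idx t \<noteq> y + n * T" if "t > ts" "loc t b = pos y" "y \<ge> i0" for t y n
    using apart[of t] locm[of t] that ts(1) per[OF that(3), of n] by auto
  have init: "chase (Suc ts) s"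
  proof -
    have l: "loc (Suc ts) b = pos s" "todo (Suc ts) b = H (Suc s)" using start[OF ts(2)] s by auto
    have le: "s < idx (Suc ts)" using s(2) idx_mono[of ts "Suc ts"] by simp
    have "idx (Suc ts) \<noteq> s + k * T" using noteq[of "Suc ts" s k] l s(1) by simp
    moreover have "idx (Suc ts) - s = k * T + (idx (Suc ts) - s) mod T" by (simp add: k_def)
    moreover have "(idx (Suc ts) - s) mod T < T" using T(1) by simp
    ultimately show ?thesis unfolding chase_def using l le by auto
  qed
  have wait: "chase (Suc t) y" if ch: "chase t y" and t: "t > ts" and nb: "b \<notin> S t" for t y
  proof -
    have "loc (Suc t) b = pos y" "todo (Suc t) b = H (Suc y)" using idle[OF nb] ch by (auto simp: chase_def)
    moreover have "idx (Suc t) \<noteq> y + Suc k * T" using calculation noteq[of "Suc t" y "Suc k"] big[OF ch t] t by simp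
    moreover have "idx (Suc t) = idx t \<or> idx (Suc t) = Suc (idx t)"
      using idx_Suc[of t] t ts(1) t2(1) by auto
    ultimately show ?thesis using ch unfolding chase_def by auto
  qed
  \<comment> \<open>A move of \<open>b\<close> raises the lead by one, or by two if \<open>m\<close>
    moves as well. Hitting the next multiple of \<open>T\<close> is a meeting.\<close>
  have advance: "\<exists>x<y. chase (Suc t) x" if ch: "chase t y" and t: "t > ts" and bS: "b \<in> S t" for t y
  proof -
    obtain x where x: "y = Suc x" "x \<ge> i0" using big[OF ch t] by (cases y) auto
    have y: "loc t b = pos y" "todo t b = label N (pos y) (pos x) # H (Suc x)"
      using ch x by (simp_all add: chase_def H_Suc ent_def)
    have nx: "loc (Suc t) b = pos x" "todo (Suc t) b = H (Suc x)"
      using follow[OF bS y(2)] neighbour_label[OF valid pos_link(2)[of x]] y(1) x by simp_all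
    have ix: "idx (Suc t) = (if m \<in> S t then Suc (idx t) else idx t)"
      using idx_Suc[of t] t ts(1) t2(1) by auto
    have ne: "idx (Suc t) \<noteq> x + Suc k * T" using noteq[of "Suc t" x "Suc k"] nx x t by simp
    have "idx (Suc t) \<noteq> y + Suc k * T"
    proof
      \<comment> \<open>The lead would jump over the multiple: \<open>m\<close> goes from
        \<open>pos x\<close> to \<open>pos y\<close> while \<open>b\<close> goes from
        \<open>pos y\<close> to \<open>pos x\<close>, a swap over one link.\<close>
      assume eq: "idx (Suc t) = y + Suc k * T"
      then have mS: "m \<in> S t" using ch ix unfolding chase_def by (auto split: if_splits)
      then have "idx t = x + Suc k * T" using eq ix x by simp
      then have "loc t m = pos x" using locm[of t] t per[OF x(2), of "Suc k"] by simp
      moreover have "loc (Suc t) m = pos y" using locm[of "Suc t"] t eq per[of y "Suc k"] x by simp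
      moreover have "half_duplex (patrol es ds ew dw) N I (c t) (S t)" using step[of t] unfolding step_def by blast
      ultimately show False
        using mS bS bm loc_Suc[OF mS] loc_Suc[OF bS] nx y unfolding half_duplex_def loc_def by metis
    qed
    then have "chase (Suc t) x" using ch nx ix ne x unfolding chase_def by (auto split: if_splits)
    then show ?thesis using x by blast
  qed
  \<comment> \<open>Infinite descent: each action of \<open>b\<close> preserves the chase at a
    smaller index, and \<open>b\<close> acts forever.\<close>
  have "\<not> chase t y" if "t > ts" for t y using that
  proof (induction y arbitrary: t rule: less_induct)
    case (less y)
    show ?case
    proof
      assume ch: "chase t y"
      obtain t' where t': "t' \<ge> t" "b \<in> S t'" "\<And>s. t \<le> s \<Longrightarrow> s < t' \<Longrightarrow> b \<notin> S s"
        using next_action[OF b, of t] by blast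
      have "chase u y" if "t \<le> u" "u \<le> t'" for u using that
      proof (induction u rule: dec_induct)
        case (step u)
        then show ?case using wait[of u y] t'(3)[of u] less.prems by simp
      qed (use ch in simp)
      then have "chase t' y" using t'(1) by blast
      then obtain x where "x < y" "chase (Suc t') x" using advance[of t' y] t'(1,2) less.prems by auto
      then show False using less.IH[of x "Suc t'"] t'(1) less.prems by simp
    qed
  qed
  then show False using init by blast
qed

end

section \<open>From meetings to gossip\<close>

lemma knows_mono:
  assumes "knows I c t a b" "t \<le> t'"
  shows "knows I c t' a b"
  using assms(2) by (induction t' rule: dec_induct) (auto intro: knows.keep assms(1))

text \<open>The hub \<open>m\<close> first collects everything, by time \<open>M\<close>, and hands
  it over at its next meeting with \<open>a\<close>.\<close>

lemma gossip_via_hub: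
  assumes fin: "finite I" and m: "m \<in> I"
    and hub: "\<And>b t. b \<in> I \<Longrightarrow> \<exists>t'\<ge>t. location (c t') b = location (c t') m" and a: "a \<in> I"
  shows "\<exists>t. \<forall>b\<in>I. knows I c t a b"
proof -
  have own: "knows I c t b b" if "b \<in> I" for b t using knows_mono[OF knows.own[OF that]] by blast
  have "\<exists>t. knows I c t m b" if b: "b \<in> I" for b
    using hub[OF b, of 0] knows.meet[OF own[OF b] m] by metis
  then obtain f where f: "\<And>b. b \<in> I \<Longrightarrow> knows I c (f b) m b" by metis
  have "finite (f ` I)" using fin by simp
  then obtain M where M: "\<And>b. b \<in> I \<Longrightarrow> f b \<le> M" using finite_nat_set_iff_bounded_le by auto
  obtain t where t: "t \<ge> M" "location (c t) a = location (c t) m" using hub[OF a] by blast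
  have "knows I c t a b" if b: "b \<in> I" for b
    using knows.meet[OF knows_mono[OF f[OF b]] a t(2)] M[OF b] t(1) by simp
  then show ?thesis by blast
qed

lemma patrol_gossip:
  assumes ds: "\<And>x. ds (es x) = x" and dw: "\<And>y. dw (ew y) = y"
  shows "self_stabilizing_gossip (patrol es ds ew dw)"
  unfolding self_stabilizing_gossip_def
proof (intro allI impI ballI)
  fix N I c a
  assume valid: "valid_network N" and fin: "finite I" and ne: "I \<noteq> {}"
    and ex: "execution (patrol es ds ew dw) N I c" and a: "a \<in> I"
  obtain S where ini: "initial N I (c 0)"
    and step: "\<And>t. step (patrol es ds ew dw) N I (S t) (c t) (c (Suc t))"
    and fair: "\<And>a t. a \<in> I \<Longrightarrow> \<exists>t'\<ge>t. a \<in> S t'"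
    using ex unfolding execution_def by blast
  show "\<exists>t. \<forall>b\<in>I. knows I c t a b"
  \<comment> \<open>By connectivity a node without ports is the whole network, and then all agents
    share it at time 0.\<close>
  proof (cases "\<exists>u\<in>nodes N. ports N u = {}")
    case True
    then obtain u where u: "u \<in> nodes N" "ports N u = {}" by blast
    then have "v = u" if "v \<in> nodes N" for v
    proof -
      have "(u, v) \<in> (links N)\<^sup>*" using valid u(1) that unfolding valid_network_def by blast
      then show ?thesis using u(2) by (cases rule: converse_rtranclE) (auto simp: ports_def)
    qed
    then have "location (c 0) b = u" if "b \<in> I" for b using ini that unfolding initial_def by blast
    then show ?thesis using a by (intro exI[of _ 0]) (metis knows.own knows.meet)
  next
    case False
    interpret patrol_run es ds ew dw N I c S
      by unfold_locales (use ds dw valid ini step fair False in auto)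
    define m where "m = Min I"
    have m: "m \<in> I" and least: "\<And>j. j < m \<Longrightarrow> j \<notin> I"
      using fin ne unfolding m_def by (auto simp: not_less[symmetric])
    obtain t0 where t0: "\<And>t. t \<ge> t0 \<Longrightarrow> todo t m = []"
      "\<And>t. t \<ge> t0 \<Longrightarrow> m \<in> S t \<Longrightarrow> \<not> (\<exists>j<m. fresh (past t m) (brd t (loc t m)) j)"
      using least_agent_settles[OF m least] by blast
    interpret patrol_settled es ds ew dw N I c S m t0
      by unfold_locales (use m least t0 in auto)
    show ?thesis using gossip_via_hub[OF fin m _ a] meets unfolding loc_def by blast
  qed
qed

text \<open>Memories and ledgers are countable, so any infinite type of states or whiteboard
  contents can hold them.\<close>

lemma infinite_UNIV_encoding:
  assumes "infinite (UNIV :: 'a set)"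
  obtains e :: "'b::countable \<Rightarrow> 'a" and d where "\<And>x. d (e x) = x"
proof -
  obtain f :: "nat \<Rightarrow> 'a" where "inj f" using assms infinite_countable_subset by blast
  then have "inj (f \<circ> (to_nat :: 'b \<Rightarrow> nat))" by (intro inj_compose) auto
  from inv_f_f[OF this] show thesis by (rule that)
qed

lemma gossip_algorithm_exists:
  assumes "infinite (UNIV :: 's set)" and "infinite (UNIV :: 'w set)"
  shows "\<exists>A :: ('s, 'w) algorithm. self_stabilizing_gossip A"
proof -
  obtain es :: "memory \<Rightarrow> 's" and ds where "\<And>x. ds (es x) = x" using infinite_UNIV_encoding[OF assms(1)] by metis
  moreover obtain ew :: "ledger \<Rightarrow> 'w" and dw where "\<And>x. dw (ew x) = x"
    using infinite_UNIV_encoding[OF assms(2)] by metis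
  ultimately show ?thesis using patrol_gossip by blast
qed


subsection \<open>The quiescence number\<close>

theorem theorem7:
  fixes k :: nat
  assumes "infinite (UNIV :: 's set)"
    and "infinite (UNIV :: 'w set)"
    and "k \<ge> 1"
  shows "quiescence_number TYPE('s) TYPE('w) k = 0 \<and>
    (\<exists>A :: ('s, 'w) algorithm. self_stabilizing_gossip A \<and> quiescent A k 0) \<and>
    (\<forall>l \<ge> 1. \<not> (\<exists>A :: ('s, 'w) algorithm. self_stabilizing_gossip A \<and> quiescent A k l))"
proof -
  \<comment> \<open>Quiescence at level 0 is witnessed by the empty set of still agents.\<close>
  have ex: "\<exists>A :: ('s, 'w) algorithm. self_stabilizing_gossip A \<and> quiescent A k 0"
    using gossip_algorithm_exists[OF assms(1,2)] unfolding quiescent_def by fastforce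
  have none: "\<not> (\<exists>A :: ('s, 'w) algorithm. self_stabilizing_gossip A \<and> quiescent A k l)"
    if "l \<ge> 1" for l
    using gossip_not_quiescent[OF _ assms(3) that] by blast
  have "(GREATEST l. \<exists>A :: ('s, 'w) algorithm. self_stabilizing_gossip A \<and> quiescent A k l) = 0"
  proof (rule Greatest_equality)
    show "\<exists>A :: ('s, 'w) algorithm. self_stabilizing_gossip A \<and> quiescent A k 0" by (rule ex)
  next
    fix l assume "\<exists>A :: ('s, 'w) algorithm. self_stabilizing_gossip A \<and> quiescent A k l"
    then have "\<not> 1 \<le> l" using none by blast
    then show "l \<le> 0" by simp
  qed
  then have "quiescence_number TYPE('s) TYPE('w) k = 0"
    using ex by (simp add: quiescence_number_def)
  then show ?thesis using ex none by blast
qed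

end
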